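(* For every $n\ge1$, the $S$-set $\mathrm{ASym}(\mathbb{Z}_{2C}^n)$ is invariant under the action of $\Delta_n$: for every $\delta_r\in\Delta_n$ and every $X_C\in\mathrm{ASym}(\mathbb{Z}_{2C}^n)$, one has $(\delta_rX)_C\in\mathrm{ASym}(\mathbb{Z}_{2C}^n)$.
   Context: $\mathbb{Z}_2=\{+,-\}=\{1,-1\}$ and $\mathbb{Z}_2^n$ is the group of $\pm1$ sequences $X=(x_0,\dots,x_{n-1})$, indices modulo $n$. $C(x_0,\dots,x_{n-1})=(x_1,\dots,x_{n-1},x_0)$ and $X_C=\{C^i(X):0\le i<n\}$; $\mathbb{Z}_{2C}^n$ is the set of all such orbits. $RX=(x_{n-1},\dots,x_1,x_0)$ is the reversal and $-X$ changes all signs. $X_C$ is antisymmetric if there exists $Y\in X_C$ with $RY=-Y$; $\mathrm{ASym}(\mathbb{Z}_{2C}^n)$ is the set of all antisymmetric $X_C$. $\Delta_n=\{\delta_r:\gcd(r,n)=1\}$, where $(\delta_rX)_i=x_{ri\bmod n}$; it acts on orbits by $\delta_r(X_C)=(\delta_rX)_C$. *)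

theory Defs
  imports Main
begin

(* A sequence (x_0, ..., x_(n-1)) of signs is an integer list of length n with entries 1 and -1.
   On such lists the shift C is rotate1, the reversal R is rev, and the sign change is
   map uminus. *)

definition Z2_seqs :: "nat \<Rightarrow> int list set" where
  "Z2_seqs n = {X. length X = n \<and> set X \<subseteq> {1, -1}}"

definition cyc_orbit :: "int list \<Rightarrow> int list set" where
  "cyc_orbit X = {(rotate1 ^^ i) X | i. i < length X}"

definition Z2C_orbits :: "nat \<Rightarrow> int list set set" where
  "Z2C_orbits n = cyc_orbit ` Z2_seqs n"

definition antisymmetric :: "int list set \<Rightarrow> bool" where
  "antisymmetric O_X \<longleftrightarrow> (\<exists>Y\<in>O_X. rev Y = map uminus Y)"

definition ASym :: "nat \<Rightarrow> int list set set" where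
  "ASym n = {O_X \<in> Z2C_orbits n. antisymmetric O_X}"

(* The index r ranges over all integers; the map depends only on r mod n. *)
definition delta :: "nat \<Rightarrow> int \<Rightarrow> int list \<Rightarrow> int list" where
  "delta n r X = map (\<lambda>i. X ! nat ((r * int i) mod int n)) [0..<n]"

definition Delta :: "nat \<Rightarrow> (int list \<Rightarrow> int list) set" where
  "Delta n = {delta n r | r. gcd r (int n) = 1}"

end

theory Submission
  imports Defs
begin

text \<open>
  Extend \<open>X\<close> periodically to the integers. Its orbit is antisymmetric iff
  \<open>x\<^sub>a = -x\<^sub>b\<close> whenever \<open>a + b \<equiv> s\<close> modulo \<open>n\<close>, for some odd integer \<open>s\<close>.
  If \<open>n\<close> is odd, then \<open>2a \<equiv> s\<close> is solvable, which gives \<open>x\<^sub>a = -x\<^sub>a\<close>; so \<open>n\<close> is even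
  and every inverse \<open>u\<close> of \<open>r\<close> modulo \<open>n\<close> is odd. Hence \<open>\<delta>\<^sub>r X\<close> has the same property
  with the odd number \<open>u s\<close> in place of \<open>s\<close>.
\<close>

definition periodic_nth :: "'a list \<Rightarrow> int \<Rightarrow> 'a" where
  "periodic_nth X k = X ! nat (k mod int (length X))"

lemma periodic_nth_cong:
  "k mod int (length X) = l mod int (length X) \<Longrightarrow> periodic_nth X k = periodic_nth X l"
  by (simp add: periodic_nth_def)

lemma periodic_nth_in_set: "X \<noteq> [] \<Longrightarrow> periodic_nth X k \<in> set X"
  by (simp add: periodic_nth_def nat_less_iff)

lemma nth_rotate_periodic:
  assumes "j < length X"
  shows "rotate i X ! j = periodic_nth X (int i + int j)"
  using assms
  by (simp add: nth_rotate periodic_nth_def add.commute nat_mod_distrib nat_add_distrib)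

text \<open>Reversing \<open>rotate i X\<close> exchanges the positions \<open>j\<close> and
  \<open>length X - 1 - j\<close>, whose indices in \<open>X\<close> add up to
  \<open>2 * int i - 1\<close> modulo the length. Keeping \<open>int i + int j\<close> unsimplified
  exhibits the reflection \<open>a\<close> to \<open>s - a\<close> with
  \<open>s = 2 * int i - 1\<close>.\<close>

lemma rotate_antisymmetric_iff:
  "rev (rotate i X) = map uminus (rotate i X) \<longleftrightarrow>
     (\<forall>j < length X. periodic_nth X (2 * int i - 1 - (int i + int j)) =
        - periodic_nth X (int i + int j))"
proof -
  have "rev (rotate i X) ! j = periodic_nth X (2 * int i - 1 - (int i + int j))"
    if "j < length X" for j
  proof -
    have "rev (rotate i X) ! j = periodic_nth X (int i + int (length X - Suc j))"
      using that by (simp add: rev_nth nth_rotate_periodic)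
    also have "\<dots> = periodic_nth X (2 * int i - 1 - (int i + int j))"
    proof (rule periodic_nth_cong)
      have "int i + int (length X - Suc j) =
          (2 * int i - 1 - (int i + int j)) + int (length X)"
        using that by (simp add: of_nat_diff)
      then show "(int i + int (length X - Suc j)) mod int (length X) =
          (2 * int i - 1 - (int i + int j)) mod int (length X)"
        by (simp only: mod_add_self2)
    qed
    finally show ?thesis .
  qed
  then show ?thesis
    by (simp add: list_eq_iff_nth_eq nth_rotate_periodic)
qed

text \<open>Rotations yield the reflection sums \<open>2 * int i - 1\<close>, and every odd integer
  is congruent to one of these modulo the length. Allowing any odd \<open>s\<close> gives a
  condition that is easy to transport under multiplication of indices.\<close>

lemma antisymmetric_cyc_orbit_iff:
  assumes "X \<noteq> []"
  shows "antisymmetric (cyc_orbit X) \<longleftrightarrow>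
    (\<exists>s. odd s \<and> (\<forall>a. periodic_nth X (s - a) = - periodic_nth X a))"
proof
  assume "antisymmetric (cyc_orbit X)"
  then obtain i where
    i: "\<forall>j < length X. periodic_nth X (2 * int i - 1 - (int i + int j)) =
      - periodic_nth X (int i + int j)"
    by (auto simp: antisymmetric_def cyc_orbit_def rotate_def[symmetric]
        rotate_antisymmetric_iff)
  have "periodic_nth X (2 * int i - 1 - a) = - periodic_nth X a" for a
  proof -
    \<comment> \<open>\<open>j\<close> is the position in \<open>rotate i X\<close> at which the
      entry of index \<open>a\<close> stands.\<close>
    define j where "j = nat ((a - int i) mod int (length X))"
    have j: "j < length X" "int j = (a - int i) mod int (length X)"
      using assms by (simp_all add: j_def nat_less_iff)
    have c: "(int i + int j) mod int (length X) = a mod int (length X)"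
      by (simp add: j mod_simps)
    then have "(2 * int i - 1 - (int i + int j)) mod int (length X) =
        (2 * int i - 1 - a) mod int (length X)"
      by (rule mod_diff_cong[OF refl])
    with c i j show ?thesis
      by (metis periodic_nth_cong)
  qed
  moreover have "odd (2 * int i - 1)" by simp
  ultimately show "\<exists>s. odd s \<and> (\<forall>a. periodic_nth X (s - a) = - periodic_nth X a)"
    by blast
next
  assume "\<exists>s. odd s \<and> (\<forall>a. periodic_nth X (s - a) = - periodic_nth X a)"
  then obtain s where s: "odd s" "\<And>a. periodic_nth X (s - a) = - periodic_nth X a"
    by blast
  \<comment> \<open>This solves \<open>2 * i - 1 = s\<close> modulo the length; the reduction keeps
    \<open>i\<close> in the range that \<open>cyc_orbit\<close> demands.\<close>
  define i where "i = nat (((s + 1) div 2) mod int (length X))"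
  have i: "i < length X" "int i = ((s + 1) div 2) mod int (length X)"
    using assms by (simp_all add: i_def nat_less_iff)
  have "periodic_nth X (2 * int i - 1 - a) = - periodic_nth X a" for a
  proof -
    have "(2 * int i - 1 - a) mod int (length X) =
        (2 * ((s + 1) div 2) - 1 - a) mod int (length X)"
      unfolding i by (intro mod_diff_cong refl) (simp add: mod_simps)
    also have "2 * ((s + 1) div 2) - 1 - a = s - a"
      using s(1) by presburger
    finally show ?thesis
      using s(2) by (metis periodic_nth_cong)
  qed
  then have "rev (rotate i X) = map uminus (rotate i X)"
    by (simp only: rotate_antisymmetric_iff simp_thms)
  then show "antisymmetric (cyc_orbit X)"
    using i(1) by (auto simp: antisymmetric_def cyc_orbit_def rotate_def[symmetric])
qed

text \<open>For odd length the reflection fixes an index, and the entry there equals its own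
  negative, hence is 0.\<close>

lemma even_length_if_antisymmetric:
  fixes X :: "int list"
  assumes X: "X \<noteq> []" "0 \<notin> set X"
    and s: "odd s" "\<And>a. periodic_nth X (s - a) = - periodic_nth X a"
  shows "even (length X)"
proof (rule ccontr)
  assume "odd (length X)"
  \<comment> \<open>Half of the even number \<open>s + int (length X)\<close> is the fixed index of
    the reflection.\<close>
  with s(1) obtain a where a: "s + int (length X) = 2 * a"
    by (metis evenE odd_even_add even_of_nat)
  have "(s - a) mod int (length X) = (s - a + int (length X)) mod int (length X)"
    by simp
  also have "s - a + int (length X) = a"
    using a by simp
  finally have "periodic_nth X a = - periodic_nth X a"
    using s(2) by (metis periodic_nth_cong)
  then show False
    using X periodic_nth_in_set[of X a] by auto
qed

lemma length_delta [simp]: "length (delta n r X) = n"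
  by (simp add: delta_def)

text \<open>On periodic extensions \<open>delta n r\<close> is plain substitution of
  \<open>r * k\<close> for \<open>k\<close>, since reducing \<open>k\<close> modulo \<open>n\<close>
  first does not change \<open>r * k\<close> modulo \<open>n\<close>.\<close>

lemma periodic_nth_delta:
  assumes "n \<ge> 1" "length X = n"
  shows "periodic_nth (delta n r X) k = periodic_nth X (r * k)"
  using assms by (simp add: periodic_nth_def delta_def nat_less_iff mod_simps)

lemma delta_in_Z2_seqs:
  assumes "n \<ge> 1" "X \<in> Z2_seqs n"
  shows "delta n r X \<in> Z2_seqs n"
proof -
  have "X ! nat (k mod int n) \<in> {1, -1}" for k
  proof -
    have "X \<noteq> []" and len: "length X = n" and "set X \<subseteq> {1, -1}"
      using assms by (auto simp: Z2_seqs_def)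
    then have "periodic_nth X k \<in> {1, -1}"
      using periodic_nth_in_set by blast
    then show ?thesis
      by (simp only: periodic_nth_def len)
  qed
  then show ?thesis
    by (auto simp: Z2_seqs_def delta_def)
qed

theorem theorem11:
  fixes n :: nat
  assumes "n \<ge> 1"
  shows "\<forall>d \<in> Delta n. \<forall>X \<in> Z2_seqs n.
           cyc_orbit X \<in> ASym n \<longrightarrow> cyc_orbit (d X) \<in> ASym n"
proof (intro ballI impI)
  fix d X
  assume "d \<in> Delta n" and X: "X \<in> Z2_seqs n" and "cyc_orbit X \<in> ASym n"
  then obtain r where d: "d = delta n r" and r: "gcd r (int n) = 1"
    by (auto simp: Delta_def)
  have len: "length X = n" and ne: "X \<noteq> []" and nz: "0 \<notin> set X"
    using X assms by (auto simp: Z2_seqs_def)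
  from \<open>cyc_orbit X \<in> ASym n\<close> ne obtain s where
    s: "odd s" "\<And>a. periodic_nth X (s - a) = - periodic_nth X a"
    by (auto simp: ASym_def antisymmetric_cyc_orbit_iff)
  have "even n"
    using even_length_if_antisymmetric[OF ne nz s] len by simp
  obtain u v where uv: "u * r + v * int n = 1"
    using bezout_int[of r "int n"] r by auto
  \<comment> \<open>Modulo 2 the term \<open>v * int n\<close> vanishes, so \<open>u * r\<close> is
    odd.\<close>
  with \<open>even n\<close> have "odd u"
    by (metis even_add even_mult_iff even_of_nat odd_one)
  \<comment> \<open>The sum \<open>u * s\<close> is chosen so that multiplication by
    \<open>r\<close> turns it back into \<open>s\<close> modulo \<open>n\<close>.\<close>
  have "periodic_nth (delta n r X) (u * s - a) = - periodic_nth (delta n r X) a" for a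
  proof -
    have "r * (u * s - a) = (u * r) * s - r * a"
      by (simp add: algebra_simps)
    also have "u * r = 1 - v * int n"
      using uv by simp
    also have "(1 - v * int n) * s - r * a = (s - r * a) + (- v * s) * int n"
      by (simp add: algebra_simps)
    finally have "r * (u * s - a) mod int n = (s - r * a) mod int n"
      by (simp only: mod_mult_self1)
    then have "periodic_nth X (r * (u * s - a)) = - periodic_nth X (r * a)"
      using s(2) len by (metis periodic_nth_cong)
    then show ?thesis
      using assms len by (simp add: periodic_nth_delta)
  qed
  moreover have "odd (u * s)"
    using \<open>odd u\<close> s(1) by simp
  moreover have "delta n r X \<noteq> []"
    using assms by (simp add: delta_def)
  ultimately have "antisymmetric (cyc_orbit (delta n r X))"
    using antisymmetric_cyc_orbit_iff by blast
  then show "cyc_orbit (d X) \<in> ASym n"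
    using delta_in_Z2_seqs[OF assms X] d by (auto simp: ASym_def Z2C_orbits_def)
qed

end
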